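(* Let a particle $p$ of mass $m>0$ move along a regular spacelike curve $\gamma$ on a timelike surface in $E_1^3$, in the setting and with the notation of the context (Darboux frame $\{T,N_M,G\}$, hyperbolic angle $\varphi$, axes $V_1,V_2$, position coefficients $\omega_1,\omega_2,\omega_3$ relative to a fixed origin $O$, oblique unit axis $J_\lambda$). Assume that the position vector $\gamma$ does not lie on the light cone ($\langle\gamma,\gamma\rangle\neq0$), that the component functions along $V_1$ and $V_2$ of the angular-momentum vector field $H=\gamma\times m\frac{d\gamma}{dt}$ are nowhere vanishing, and that $\omega_1^2\neq\omega_2^2$ everywhere (so that $J_\lambda$ is defined). Then the acceleration vector $a=\frac{d^2\gamma}{dt^2}$ can be uniquely decomposed along $T$ and $J_\lambda$ as $$a=\left(\frac{d^{2}s}{dt^{2}}-\left(\frac{ds}{dt}\right)^{2}\sqrt{k_n^{2}-k_g^{2}}\,\frac{1}{\omega_2}\int\left(1-\omega_2\sqrt{k_n^{2}-k_g^{2}}\right)ds\right)T+\sqrt{k_n^{2}-k_g^{2}}\left(\frac{ds}{dt}\right)^{2}\frac{1}{\omega_2}\sqrt{\left|\left(\int(1-\omega_2\kappa)\,ds\right)^{2}-\omega_2^{2}\right|}\;J_\lambda,$$ where $\kappa=\sqrt{k_n^{2}-k_g^{2}}$, $\tau=\tau_g+\varphi'$, and $\int(1-\omega_2\kappa)\,ds$ denotes the antiderivative (with respect to $s$) of $1-\omega_2\kappa$ whose constant of integration is such that it equals $\omega_1$.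
   Context: $E_1^3$ is $\mathbb{R}^3$ with the metric $\langle V,W\rangle=V_1W_1+V_2W_2-V_3W_3$. The Lorentz vector product is $V\times W=(V_2W_3-V_3W_2,\;V_3W_1-V_1W_3,\;-(V_1W_2-V_2W_1))$. A surface is timelike if its induced metric is Lorentzian; then its unit normal field $N_M$ is spacelike. Setting. $\gamma=\gamma(s)$ is a smooth spacelike curve parametrized by arc length $s$ on a timelike surface, with position vector taken relative to a fixed origin $O$; $T=d\gamma/ds$, $\langle T,T\rangle=1$. Primes denote $d/ds$. The curve has a pseudo-orthonormal Frenet frame $\{T,N,B\}$ with $N$ timelike, $\langle N,N\rangle=-1$, $\langle B,B\rangle=1$, and smooth functions $\kappa\ge 0$ (curvature) and $\tau$ (torsion) with $T'=\kappa N$, $N'=\kappa T+\tau B$, $B'=\tau N$. The Darboux frame is $\{T,N_M,G\}$ with $N_M$ the unit spacelike surface normal along $\gamma$ and $G=-T\times N_M$; it is pseudo-orthonormal with $\langle T,T\rangle=\langle N_M,N_M\rangle=1$, $\langle G,G\rangle=-1$. The vectors $N$ and $G$ lie in the same time cone, and $\varphi$ is the smooth hyperbolic angle with $N_M=-\sinh\varphi\,N+\cosh\varphi\,B$, $G=\cosh\varphi\,N-\sinh\varphi\,B$. Then $T'=k_gN_M+k_nG$, $N_M'=-k_gT+\tau_gG$, $G'=k_nT+\tau_gN_M$, where $k_g=\kappa\sinh\varphi$ (geodesic curvature), $k_n=\kappa\cosh\varphi$ (normal curvature), $\tau_g=\tau-\varphi'$ (geodesic torsion). The particle's position at time $t$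 is $\gamma(s(t))$ with $s(t)$ smooth; velocity $d\gamma/dt$, acceleration $a=d^2\gamma/dt^2$. Put $V_1=\sinh\varphi\,N_M+\cosh\varphi\,G$ and $V_2=\cosh\varphi\,N_M+\sinh\varphi\,G$. The functions $\omega_1,\omega_2,\omega_3$ are the coefficients of the position vector: $\gamma=\omega_1T+\omega_2V_1+\omega_3V_2$. Put $\lambda=\omega_1T+\omega_2V_1$ and $J_\lambda=\lambda/\sqrt{|\omega_1^2-\omega_2^2|}$. The component functions of $H$ along $V_1,V_2$ are the coefficients of $V_1,V_2$ of $H$ in the basis $\{T,V_1,V_2\}$. *)

theory Defs
  imports "HOL-Analysis.Analysis"
begin

definition lorentz_inner :: "real^3 \<Rightarrow> real^3 \<Rightarrow> real" where
  "lorentz_inner v w = v$1 * w$1 + v$2 * w$2 - v$3 * w$3"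

definition lorentz_cross :: "real^3 \<Rightarrow> real^3 \<Rightarrow> real^3" where
  "lorentz_cross v w = vector
     [v$2 * w$3 - v$3 * w$2,
      v$3 * w$1 - v$1 * w$3,
      - (v$1 * w$2 - v$2 * w$1)]"

text \<open>Intended for timelike \<open>v\<close> and \<open>w\<close>; then a negative product means that both point
  to the same (future or past) half of the time cone.\<close>

definition same_time_cone :: "real^3 \<Rightarrow> real^3 \<Rightarrow> bool" where
  "same_time_cone v w \<longleftrightarrow> lorentz_inner v w < 0"

text \<open>\<open>C k\<close> regularity through iterated directional derivatives; meaningful for open \<open>S\<close> only,
  since the derivatives are taken at \<open>x\<close> in the whole space.\<close>

primrec Ck_on :: "nat \<Rightarrow> 'a::euclidean_space set \<Rightarrow> ('a \<Rightarrow> 'b::euclidean_space) \<Rightarrow> bool" where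
  "Ck_on 0 S f \<longleftrightarrow> continuous_on S f"
| "Ck_on (Suc k) S f \<longleftrightarrow> (\<forall>x\<in>S. f differentiable (at x)) \<and>
     (\<forall>v. Ck_on k S (\<lambda>x. frechet_derivative f (at x) v))"

definition smooth_on :: "'a::euclidean_space set \<Rightarrow> ('a \<Rightarrow> 'b::euclidean_space) \<Rightarrow> bool" where
  "smooth_on S f \<longleftrightarrow> (\<forall>k. Ck_on k S f)"

definition local_parametrization :: "(real^3) set \<Rightarrow> (real^2) set \<Rightarrow> (real^2 \<Rightarrow> real^3) \<Rightarrow> bool" where
  "local_parametrization M U X \<longleftrightarrow>
     open U \<and> smooth_on U X \<and> openin (top_of_set M) (X ` U) \<and>
     (\<exists>Y. homeomorphism U (X ` U) X Y) \<and>
     (\<forall>u\<in>U. inj (frechet_derivative X (at u)))"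

definition regular_surface :: "(real^3) set \<Rightarrow> bool" where
  "regular_surface M \<longleftrightarrow> (\<forall>p\<in>M. \<exists>U X. local_parametrization M U X \<and> p \<in> X ` U)"

definition tangent_plane :: "(real^3) set \<Rightarrow> real^3 \<Rightarrow> (real^3) set" where
  "tangent_plane M p = {v. \<exists>e>0. \<exists>c. smooth_on {-e<..<e} c \<and> c ` {-e<..<e} \<subseteq> M \<and>
     c 0 = p \<and> (c has_vector_derivative v) (at 0)}"

text \<open>The induced metric is Lorentzian: each tangent plane has a pseudo-orthonormal basis of
  signature \<open>(+,-)\<close>.\<close>

definition timelike_surface :: "(real^3) set \<Rightarrow> bool" where
  "timelike_surface M \<longleftrightarrow> regular_surface M \<and>
     (\<forall>p\<in>M. \<exists>e f. tangent_plane M p = span {e, f} \<and> lorentz_inner e e = 1 \<and>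
        lorentz_inner f f = -1 \<and> lorentz_inner e f = 0)"

definition unit_tangent :: "(real \<Rightarrow> real^3) \<Rightarrow> real \<Rightarrow> real^3" where
  "unit_tangent \<gamma> \<sigma> = vector_derivative \<gamma> (at \<sigma>)"

definition spacelike_arclength_curve_on :: "real set \<Rightarrow> (real^3) set \<Rightarrow> (real \<Rightarrow> real^3) \<Rightarrow> bool" where
  "spacelike_arclength_curve_on I M \<gamma> \<longleftrightarrow>
     open I \<and> is_interval I \<and> smooth_on I \<gamma> \<and> \<gamma> ` I \<subseteq> M \<and>
     (\<forall>\<sigma>\<in>I. lorentz_inner (unit_tangent \<gamma> \<sigma>) (unit_tangent \<gamma> \<sigma>) = 1)"

definition frenet_frame_on :: "real set \<Rightarrow> (real \<Rightarrow> real^3) \<Rightarrow> (real \<Rightarrow> real^3) \<Rightarrow> (real \<Rightarrow> real^3) \<Rightarrow>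
    (real \<Rightarrow> real) \<Rightarrow> (real \<Rightarrow> real) \<Rightarrow> bool" where
  "frenet_frame_on I \<gamma> N B \<kappa> \<tau> \<longleftrightarrow>
     smooth_on I N \<and> smooth_on I B \<and> smooth_on I \<kappa> \<and> smooth_on I \<tau> \<and>
     (\<forall>\<sigma>\<in>I. let T = unit_tangent \<gamma> in
        lorentz_inner (T \<sigma>) (T \<sigma>) = 1 \<and> lorentz_inner (N \<sigma>) (N \<sigma>) = -1 \<and>
        lorentz_inner (B \<sigma>) (B \<sigma>) = 1 \<and> lorentz_inner (T \<sigma>) (N \<sigma>) = 0 \<and>
        lorentz_inner (T \<sigma>) (B \<sigma>) = 0 \<and> lorentz_inner (N \<sigma>) (B \<sigma>) = 0 \<and>
        \<kappa> \<sigma> \<ge> 0 \<and>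
        (T has_vector_derivative \<kappa> \<sigma> *\<^sub>R N \<sigma>) (at \<sigma>) \<and>
        (N has_vector_derivative \<kappa> \<sigma> *\<^sub>R T \<sigma> + \<tau> \<sigma> *\<^sub>R B \<sigma>) (at \<sigma>) \<and>
        (B has_vector_derivative \<tau> \<sigma> *\<^sub>R N \<sigma>) (at \<sigma>))"

definition darboux_frame_on :: "real set \<Rightarrow> (real^3) set \<Rightarrow> (real \<Rightarrow> real^3) \<Rightarrow>
    (real \<Rightarrow> real^3) \<Rightarrow> (real \<Rightarrow> real^3) \<Rightarrow> bool" where
  "darboux_frame_on I M \<gamma> NM G \<longleftrightarrow>
     (\<forall>\<sigma>\<in>I. lorentz_inner (NM \<sigma>) (NM \<sigma>) = 1 \<and>
        (\<forall>v\<in>tangent_plane M (\<gamma> \<sigma>). lorentz_inner (NM \<sigma>) v = 0) \<and>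
        G \<sigma> = - lorentz_cross (unit_tangent \<gamma> \<sigma>) (NM \<sigma>))"

definition hyperbolic_angle_on :: "real set \<Rightarrow> (real \<Rightarrow> real^3) \<Rightarrow> (real \<Rightarrow> real^3) \<Rightarrow>
    (real \<Rightarrow> real^3) \<Rightarrow> (real \<Rightarrow> real^3) \<Rightarrow> (real \<Rightarrow> real) \<Rightarrow> bool" where
  "hyperbolic_angle_on I N B NM G \<phi> \<longleftrightarrow> smooth_on I \<phi> \<and>
     (\<forall>\<sigma>\<in>I. same_time_cone (N \<sigma>) (G \<sigma>) \<and>
        NM \<sigma> = - sinh (\<phi> \<sigma>) *\<^sub>R N \<sigma> + cosh (\<phi> \<sigma>) *\<^sub>R B \<sigma> \<and>
        G \<sigma> = cosh (\<phi> \<sigma>) *\<^sub>R N \<sigma> - sinh (\<phi> \<sigma>) *\<^sub>R B \<sigma>)"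

text \<open>With \<open>T\<close> the unit tangent, the next three are the coefficients in the Darboux equations
  \<open>T' = k\<^sub>g N\<^sub>M + k\<^sub>n G\<close>, \<open>N\<^sub>M' = - k\<^sub>g T + \<tau>\<^sub>g G\<close>, \<open>G' = k\<^sub>n T + \<tau>\<^sub>g N\<^sub>M\<close>; these equations follow
  from the Frenet equations and the hyperbolic rotation above.\<close>

definition geodesic_curvature :: "(real \<Rightarrow> real) \<Rightarrow> (real \<Rightarrow> real) \<Rightarrow> real \<Rightarrow> real" where
  "geodesic_curvature \<kappa> \<phi> \<sigma> = \<kappa> \<sigma> * sinh (\<phi> \<sigma>)"

definition normal_curvature :: "(real \<Rightarrow> real) \<Rightarrow> (real \<Rightarrow> real) \<Rightarrow> real \<Rightarrow> real" where
  "normal_curvature \<kappa> \<phi> \<sigma> = \<kappa> \<sigma> * cosh (\<phi> \<sigma>)"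

definition geodesic_torsion :: "(real \<Rightarrow> real) \<Rightarrow> (real \<Rightarrow> real) \<Rightarrow> real \<Rightarrow> real" where
  "geodesic_torsion \<tau> \<phi> \<sigma> = \<tau> \<sigma> - deriv \<phi> \<sigma>"

definition axis1 :: "(real \<Rightarrow> real^3) \<Rightarrow> (real \<Rightarrow> real^3) \<Rightarrow> (real \<Rightarrow> real) \<Rightarrow> real \<Rightarrow> real^3" where
  "axis1 NM G \<phi> \<sigma> = sinh (\<phi> \<sigma>) *\<^sub>R NM \<sigma> + cosh (\<phi> \<sigma>) *\<^sub>R G \<sigma>"

definition axis2 :: "(real \<Rightarrow> real^3) \<Rightarrow> (real \<Rightarrow> real^3) \<Rightarrow> (real \<Rightarrow> real) \<Rightarrow> real \<Rightarrow> real^3" where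
  "axis2 NM G \<phi> \<sigma> = cosh (\<phi> \<sigma>) *\<^sub>R NM \<sigma> + sinh (\<phi> \<sigma>) *\<^sub>R G \<sigma>"

definition oblique_axis :: "(real \<Rightarrow> real^3) \<Rightarrow> (real \<Rightarrow> real^3) \<Rightarrow> (real \<Rightarrow> real) \<Rightarrow> (real \<Rightarrow> real) \<Rightarrow>
    real \<Rightarrow> real^3" where
  "oblique_axis T V\<^sub>1 \<omega>\<^sub>1 \<omega>\<^sub>2 \<sigma> =
     (\<omega>\<^sub>1 \<sigma> *\<^sub>R T \<sigma> + \<omega>\<^sub>2 \<sigma> *\<^sub>R V\<^sub>1 \<sigma>) /\<^sub>R sqrt \<bar>(\<omega>\<^sub>1 \<sigma>)\<^sup>2 - (\<omega>\<^sub>2 \<sigma>)\<^sup>2\<bar>"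

text \<open>In the following, \<open>\<gamma>\<close> is a curve with parameter \<open>\<sigma>\<close> and \<open>s\<close> maps time to that parameter.\<close>

definition velocity :: "(real \<Rightarrow> real^3) \<Rightarrow> (real \<Rightarrow> real) \<Rightarrow> real \<Rightarrow> real^3" where
  "velocity \<gamma> s t = vector_derivative (\<lambda>u. \<gamma> (s u)) (at t)"

definition acceleration :: "(real \<Rightarrow> real^3) \<Rightarrow> (real \<Rightarrow> real) \<Rightarrow> real \<Rightarrow> real^3" where
  "acceleration \<gamma> s t = vector_derivative (velocity \<gamma> s) (at t)"

definition angular_momentum :: "real \<Rightarrow> real^3 \<Rightarrow> (real \<Rightarrow> real^3) \<Rightarrow> (real \<Rightarrow> real) \<Rightarrow> real \<Rightarrow> real^3" where
  "angular_momentum m origin \<gamma> s t =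
     lorentz_cross (\<gamma> (s t) - origin) (m *\<^sub>R velocity \<gamma> s t)"

definition unique_decomposition :: "real^3 \<Rightarrow> real^3 \<Rightarrow> real^3 \<Rightarrow> real \<Rightarrow> real \<Rightarrow> bool" where
  "unique_decomposition a u v p q \<longleftrightarrow> a = p *\<^sub>R u + q *\<^sub>R v \<and>
     (\<forall>p' q'. a = p' *\<^sub>R u + q' *\<^sub>R v \<longrightarrow> p' = p \<and> q' = q)"

end

theory Submission
  imports Defs
begin

text \<open>
  The hyperbolic rotations defining the Darboux frame and the axes \<open>V\<^sub>1, V\<^sub>2\<close> cancel, so
  \<open>V\<^sub>1 = N\<close> and \<open>V\<^sub>2 = B\<close>. Hence \<open>a = s'' T + s'\<^sup>2 \<kappa> V\<^sub>1\<close>, and it remains to replace \<open>V\<^sub>1\<close> by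
  \<open>(\<lambda> - \<omega>\<^sub>1 T) / \<omega>\<^sub>2\<close>. The \<open>V\<^sub>2\<close>-component of the angular momentum is proportional to \<open>\<omega>\<^sub>2\<close>, so
  its non-vanishing allows the division. Differentiating \<open>\<omega>\<^sub>1 = \<langle>\<gamma>, T\<rangle>\<close> gives
  \<open>\<omega>\<^sub>1' = 1 - \<omega>\<^sub>2 \<kappa>\<close>, because \<open>\<langle>\<gamma>, N\<rangle> = - \<omega>\<^sub>2\<close>.
\<close>

text \<open>Bilinear maps between finite-dimensional spaces are bounded. The interpretation that
  follows supplies the Leibniz rule for \<open>lorentz_inner\<close>, by which \<langle>\<gamma>,
  T\<rangle> is differentiated.\<close>

lemma bounded_bilinear_lorentz_inner: "bounded_bilinear lorentz_inner"
  unfolding bilinear_conv_bounded_bilinear[symmetric] bilinear_def lorentz_inner_def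
  by (auto intro!: linearI simp: algebra_simps)

interpretation lorentz: bounded_bilinear lorentz_inner
  by (rule bounded_bilinear_lorentz_inner)

lemma lorentz_inner_commute: "lorentz_inner v w = lorentz_inner w v"
  by (simp add: lorentz_inner_def mult.commute)

lemma lorentz_cross_add_left: "lorentz_cross (u + v) w = lorentz_cross u w + lorentz_cross v w"
  and lorentz_cross_scaleR_left: "lorentz_cross (c *\<^sub>R u) w = c *\<^sub>R lorentz_cross u w"
  and lorentz_cross_scaleR_right: "lorentz_cross u (c *\<^sub>R w) = c *\<^sub>R lorentz_cross u w"
  by (simp_all add: lorentz_cross_def vec_eq_iff forall_3 algebra_simps)

lemma lorentz_cross_self [simp]: "lorentz_cross v v = 0"
  by (simp add: lorentz_cross_def vec_eq_iff forall_3)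

text \<open>Later applied to \<open>lorentz_cross B T\<close>, which therefore contributes nothing
  to the component of the angular momentum along \<open>B\<close>.\<close>

lemma lorentz_inner_cross_self [simp]: "lorentz_inner (lorentz_cross v w) v = 0"
  by (simp add: lorentz_cross_def lorentz_inner_def algebra_simps)

lemma smooth_on_differentiable_at:
  assumes "smooth_on S f" "x \<in> S"
  shows "f differentiable (at x)"
  using assms unfolding smooth_on_def by (metis Ck_on.simps(2))

lemma frechet_derivative_eq_deriv:
  fixes f :: "real \<Rightarrow> real"
  assumes "f differentiable (at x)"
  shows "frechet_derivative f (at x) 1 = deriv f x"
  using assms
  by (metis DERIV_deriv_iff_real_differentiable frechet_derivative_at has_field_derivative_def mult.right_neutral)

text \<open>\<open>Ck_on\<close> speaks of Frechet derivatives in a fixed direction; direction 1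
  gives the ordinary derivative. The two are known to agree on \<open>S\<close> only, so openness of
  \<open>S\<close> is what transfers differentiability at \<open>x\<close>.\<close>

lemma smooth_on_deriv_differentiable_at:
  fixes f :: "real \<Rightarrow> real"
  assumes "smooth_on S f" "open S" "x \<in> S"
  shows "deriv f differentiable (at x)"
proof -
  have "Ck_on (Suc (Suc 0)) S f"
    using assms(1) unfolding smooth_on_def by blast
  then have "(\<lambda>y. frechet_derivative f (at y) 1) differentiable (at x)"
    using assms(3) by simp
  moreover have "frechet_derivative f (at y) 1 = deriv f y" if "y \<in> S" for y
    using that assms(1) by (simp add: frechet_derivative_eq_deriv smooth_on_differentiable_at)
  ultimately show ?thesis
    using assms(2,3)
    by (metis (no_types, lifting) differentiable_def has_derivative_transform_within_open)
qed

lemma velocity_eq: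
  assumes "\<gamma> differentiable (at (s t))" "s differentiable (at t)"
  shows "velocity \<gamma> s t = deriv s t *\<^sub>R unit_tangent \<gamma> (s t)"
proof -
  have "(s has_vector_derivative deriv s t) (at t)"
    using assms(2) by (simp add: DERIV_deriv_iff_real_differentiable has_real_derivative_iff_has_vector_derivative[symmetric])
  moreover have "(\<gamma> has_vector_derivative unit_tangent \<gamma> (s t)) (at (s t))"
    using assms(1) by (simp add: unit_tangent_def vector_derivative_works[symmetric])
  ultimately have "((\<gamma> \<circ> s) has_vector_derivative deriv s t *\<^sub>R unit_tangent \<gamma> (s t)) (at t)"
    by (rule vector_diff_chain_at)
  then show ?thesis
    by (simp add: velocity_def o_def vector_derivative_at)
qed

text \<open>Product and chain rule applied to the velocity s' T. The velocity formula has to hold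
  near \<open>t\<close>, not just at \<open>t\<close>, so \<gamma> is required to be differentiable
  along all of \<open>J\<close>. The vector \<open>K\<close> will be the Frenet value of T'.\<close>

lemma acceleration_eq:
  assumes "open J" "t \<in> J" "smooth_on J s"
    and \<gamma>: "\<And>u. u \<in> J \<Longrightarrow> \<gamma> differentiable (at (s u))"
    and T': "(unit_tangent \<gamma> has_vector_derivative K) (at (s t))"
  shows "acceleration \<gamma> s t = deriv (deriv s) t *\<^sub>R unit_tangent \<gamma> (s t) + (deriv s t)\<^sup>2 *\<^sub>R K"
proof -
  have s': "(s has_vector_derivative deriv s t) (at t)"
    using smooth_on_differentiable_at[OF assms(3,2)]
    by (simp add: DERIV_deriv_iff_real_differentiable has_real_derivative_iff_has_vector_derivative[symmetric])
  have s'': "(deriv s has_real_derivative deriv (deriv s) t) (at t)"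
    using smooth_on_deriv_differentiable_at[OF assms(3,1,2)]
    by (simp add: DERIV_deriv_iff_real_differentiable)
  have "((\<lambda>u. unit_tangent \<gamma> (s u)) has_vector_derivative deriv s t *\<^sub>R K) (at t)"
    using vector_diff_chain_at[OF s' T'] by (simp add: o_def)
  from has_vector_derivative_scaleR[OF s'' this]
  have "((\<lambda>u. deriv s u *\<^sub>R unit_tangent \<gamma> (s u)) has_vector_derivative
      deriv (deriv s) t *\<^sub>R unit_tangent \<gamma> (s t) + (deriv s t)\<^sup>2 *\<^sub>R K) (at t)"
    by (simp add: power2_eq_square add.commute)
  moreover have "deriv s u *\<^sub>R unit_tangent \<gamma> (s u) = velocity \<gamma> s u" if "u \<in> J" for u
    using velocity_eq[of \<gamma> s u, OF \<gamma>[OF that]] smooth_on_differentiable_at[OF assms(3) that] by simp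
  ultimately have "(velocity \<gamma> s has_vector_derivative
      deriv (deriv s) t *\<^sub>R unit_tangent \<gamma> (s t) + (deriv s t)\<^sup>2 *\<^sub>R K) (at t)"
    using assms(1,2) has_vector_derivative_transform_within_open by blast
  then show ?thesis
    by (simp add: acceleration_def vector_derivative_at)
qed

text \<open>Substitution cancels the mixed terms and leaves the factor cosh^2 - sinh^2 = 1; this is
  linear algebra in any real vector space.\<close>

lemma hyperbolic_rotation_inverse:
  fixes N B :: "'a::real_vector"
  assumes "NM = - sinh x *\<^sub>R N + cosh x *\<^sub>R B" "G = cosh x *\<^sub>R N - sinh x *\<^sub>R B"
  shows "sinh x *\<^sub>R NM + cosh x *\<^sub>R G = N"
    and "cosh x *\<^sub>R NM + sinh x *\<^sub>R G = B"
proof -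
  have *: "(cosh x * cosh x) *\<^sub>R v = (sinh x * sinh x) *\<^sub>R v + v" for v :: 'a
    using cosh_square_eq[of x] by (simp add: power2_eq_square scaleR_left_distrib)
  show "sinh x *\<^sub>R NM + cosh x *\<^sub>R G = N" "cosh x *\<^sub>R NM + sinh x *\<^sub>R G = B"
    by (simp_all add: assms algebra_simps *)
qed

text \<open>With J the oblique axis and r its normalizing root, \<open>V \<sigma>\<close> is (r J -
  \<open>\<omega>\<^sub>1\<close> T) / \<open>\<omega>\<^sub>2\<close>; inserting this gives the
  coefficients. They are unique because T and V are independent and J has the nonzero V-coefficient
  \<open>\<omega>\<^sub>2\<close> / r.\<close>

lemma unique_decomposition_oblique_axis:
  assumes TT: "lorentz_inner (T \<sigma>) (T \<sigma>) = 1" and VV: "lorentz_inner (V \<sigma>) (V \<sigma>) = -1"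
    and TV: "lorentz_inner (T \<sigma>) (V \<sigma>) = 0"
    and "\<omega>\<^sub>2 \<sigma> \<noteq> 0" "(\<omega>\<^sub>1 \<sigma>)\<^sup>2 \<noteq> (\<omega>\<^sub>2 \<sigma>)\<^sup>2"
  shows "unique_decomposition (p *\<^sub>R T \<sigma> + q *\<^sub>R V \<sigma>) (T \<sigma>) (oblique_axis T V \<omega>\<^sub>1 \<omega>\<^sub>2 \<sigma>)
    (p - q * (1 / \<omega>\<^sub>2 \<sigma>) * \<omega>\<^sub>1 \<sigma>) (q * (1 / \<omega>\<^sub>2 \<sigma>) * sqrt \<bar>(\<omega>\<^sub>1 \<sigma>)\<^sup>2 - (\<omega>\<^sub>2 \<sigma>)\<^sup>2\<bar>)"
proof -
  define r where "r = sqrt \<bar>(\<omega>\<^sub>1 \<sigma>)\<^sup>2 - (\<omega>\<^sub>2 \<sigma>)\<^sup>2\<bar>"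
  have r: "r \<noteq> 0"
    using assms(5) by (simp add: r_def)
  \<comment> \<open>Rewriting everything in terms of T and V reduces both existence and uniqueness
    to a comparison of coefficients.\<close>
  have J: "p' *\<^sub>R T \<sigma> + q' *\<^sub>R oblique_axis T V \<omega>\<^sub>1 \<omega>\<^sub>2 \<sigma>
      = (p' + q' * \<omega>\<^sub>1 \<sigma> / r) *\<^sub>R T \<sigma> + (q' * \<omega>\<^sub>2 \<sigma> / r) *\<^sub>R V \<sigma>" for p' q'
    by (simp add: oblique_axis_def r_def[symmetric] algebra_simps divide_inverse)
  \<comment> \<open>Pairing with T and with V reads off the two coefficients, the second up to sign
    since V is timelike.\<close>
  have inj: "a = c \<and> b = d" if "a *\<^sub>R T \<sigma> + b *\<^sub>R V \<sigma> = c *\<^sub>R T \<sigma> + d *\<^sub>R V \<sigma>" for a b c d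
  proof -
    have "lorentz_inner (a *\<^sub>R T \<sigma> + b *\<^sub>R V \<sigma>) (T \<sigma>) = lorentz_inner (c *\<^sub>R T \<sigma> + d *\<^sub>R V \<sigma>) (T \<sigma>)"
      "lorentz_inner (a *\<^sub>R T \<sigma> + b *\<^sub>R V \<sigma>) (V \<sigma>) = lorentz_inner (c *\<^sub>R T \<sigma> + d *\<^sub>R V \<sigma>) (V \<sigma>)"
      using that by simp_all
    then show ?thesis
      using TT VV TV lorentz_inner_commute[of "V \<sigma>" "T \<sigma>"]
      by (simp add: lorentz.add_left lorentz.scaleR_left)
  qed
  show ?thesis
    unfolding unique_decomposition_def J r_def[symmetric]
  proof (intro conjI allI impI)
    show "p *\<^sub>R T \<sigma> + q *\<^sub>R V \<sigma> =
      (p - q * (1 / \<omega>\<^sub>2 \<sigma>) * \<omega>\<^sub>1 \<sigma> + q * (1 / \<omega>\<^sub>2 \<sigma>) * r * \<omega>\<^sub>1 \<sigma> / r) *\<^sub>R T \<sigma> +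
      (q * (1 / \<omega>\<^sub>2 \<sigma>) * r * \<omega>\<^sub>2 \<sigma> / r) *\<^sub>R V \<sigma>"
      using r assms(4) by simp
  next
    fix p' q'
    assume "p *\<^sub>R T \<sigma> + q *\<^sub>R V \<sigma> = (p' + q' * \<omega>\<^sub>1 \<sigma> / r) *\<^sub>R T \<sigma> + (q' * \<omega>\<^sub>2 \<sigma> / r) *\<^sub>R V \<sigma>"
    from inj[OF this] have p: "p = p' + q' * \<omega>\<^sub>1 \<sigma> / r" and q: "q = q' * \<omega>\<^sub>2 \<sigma> / r"
      by simp_all
    show "q' = q * (1 / \<omega>\<^sub>2 \<sigma>) * r"
      using q r assms(4) by simp
    show "p' = p - q * (1 / \<omega>\<^sub>2 \<sigma>) * \<omega>\<^sub>1 \<sigma>"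
      using p q r assms(4) by simp
  qed
qed

theorem theorem3:
  fixes M :: "(real^3) set" and I J :: "real set"
    and \<gamma> T N B NM G V\<^sub>1 V\<^sub>2 :: "real \<Rightarrow> real^3"
    and origin :: "real^3"
    and \<kappa> \<tau> \<phi> k\<^sub>g k\<^sub>n \<tau>\<^sub>g s \<omega>\<^sub>1 \<omega>\<^sub>2 \<omega>\<^sub>3 h\<^sub>0 h\<^sub>1 h\<^sub>2 :: "real \<Rightarrow> real"
    and m :: real
  assumes "timelike_surface M"
    and "spacelike_arclength_curve_on I M \<gamma>"
    and "T = unit_tangent \<gamma>"
    and "frenet_frame_on I \<gamma> N B \<kappa> \<tau>"
    and "darboux_frame_on I M \<gamma> NM G"
    and "hyperbolic_angle_on I N B NM G \<phi>"
    and "k\<^sub>g = geodesic_curvature \<kappa> \<phi>"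
    and "k\<^sub>n = normal_curvature \<kappa> \<phi>"
    and "\<tau>\<^sub>g = geodesic_torsion \<tau> \<phi>"
    and "V\<^sub>1 = axis1 NM G \<phi>"
    and "V\<^sub>2 = axis2 NM G \<phi>"
    and "m > 0"
    and "open J" "is_interval J" "smooth_on J s" "s ` J \<subseteq> I"
    and "\<forall>\<sigma>\<in>I. \<gamma> \<sigma> - origin = \<omega>\<^sub>1 \<sigma> *\<^sub>R T \<sigma> + \<omega>\<^sub>2 \<sigma> *\<^sub>R V\<^sub>1 \<sigma> + \<omega>\<^sub>3 \<sigma> *\<^sub>R V\<^sub>2 \<sigma>"
    and "\<forall>\<sigma>\<in>I. lorentz_inner (\<gamma> \<sigma> - origin) (\<gamma> \<sigma> - origin) \<noteq> 0"
    and "\<forall>t\<in>J. angular_momentum m origin \<gamma> s t =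
           h\<^sub>0 t *\<^sub>R T (s t) + h\<^sub>1 t *\<^sub>R V\<^sub>1 (s t) + h\<^sub>2 t *\<^sub>R V\<^sub>2 (s t)"
    and "\<forall>t\<in>J. h\<^sub>1 t \<noteq> 0 \<and> h\<^sub>2 t \<noteq> 0"
    and "\<forall>\<sigma>\<in>I. (\<omega>\<^sub>1 \<sigma>)\<^sup>2 \<noteq> (\<omega>\<^sub>2 \<sigma>)\<^sup>2"
  shows "(\<forall>\<sigma>\<in>I. \<kappa> \<sigma> = sqrt ((k\<^sub>n \<sigma>)\<^sup>2 - (k\<^sub>g \<sigma>)\<^sup>2) \<and> \<tau> \<sigma> = \<tau>\<^sub>g \<sigma> + deriv \<phi> \<sigma>) \<and>
    (\<exists>F. (\<forall>\<sigma>\<in>I. (F has_real_derivative (1 - \<omega>\<^sub>2 \<sigma> * sqrt ((k\<^sub>n \<sigma>)\<^sup>2 - (k\<^sub>g \<sigma>)\<^sup>2))) (at \<sigma>)) \<and>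
         (\<forall>\<sigma>\<in>I. F \<sigma> = \<omega>\<^sub>1 \<sigma>) \<and>
         (\<forall>t\<in>J. unique_decomposition (acceleration \<gamma> s t)
            (T (s t)) (oblique_axis T V\<^sub>1 \<omega>\<^sub>1 \<omega>\<^sub>2 (s t))
            (deriv (deriv s) t -
               (deriv s t)\<^sup>2 * sqrt ((k\<^sub>n (s t))\<^sup>2 - (k\<^sub>g (s t))\<^sup>2) * (1 / \<omega>\<^sub>2 (s t)) * F (s t))
            (sqrt ((k\<^sub>n (s t))\<^sup>2 - (k\<^sub>g (s t))\<^sup>2) * (deriv s t)\<^sup>2 * (1 / \<omega>\<^sub>2 (s t)) *
               sqrt \<bar>(F (s t))\<^sup>2 - (\<omega>\<^sub>2 (s t))\<^sup>2\<bar>)))"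
proof (intro conjI)
  note \<gamma>_curve = assms(2)[unfolded spacelike_arclength_curve_on_def, folded assms(3)]
  note frenet = assms(4)[unfolded frenet_frame_on_def Let_def, folded assms(3)]
  note angle = assms(6)[unfolded hyperbolic_angle_on_def]
  have \<gamma>_diff: "\<gamma> differentiable (at \<sigma>)" if "\<sigma> \<in> I" for \<sigma>
    using \<gamma>_curve that by (auto intro: smooth_on_differentiable_at)
  have V1: "V\<^sub>1 \<sigma> = N \<sigma>" and V2: "V\<^sub>2 \<sigma> = B \<sigma>" if "\<sigma> \<in> I" for \<sigma>
    using hyperbolic_rotation_inverse[of "NM \<sigma>" "\<phi> \<sigma>" "N \<sigma>" "B \<sigma>" "G \<sigma>"] angle that
    by (simp_all add: assms(10,11) axis1_def axis2_def)
  have \<kappa>: "sqrt ((k\<^sub>n \<sigma>)\<^sup>2 - (k\<^sub>g \<sigma>)\<^sup>2) = \<kappa> \<sigma>" if "\<sigma> \<in> I" for \<sigma>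
  proof -
    have "(k\<^sub>n \<sigma>)\<^sup>2 - (k\<^sub>g \<sigma>)\<^sup>2 = (\<kappa> \<sigma>)\<^sup>2"
      by (simp add: assms(7,8) geodesic_curvature_def normal_curvature_def power_mult_distrib
          cosh_square_eq algebra_simps)
    \<comment> \<open>The Frenet condition \<open>\<kappa> \<sigma> \<ge> 0\<close> makes the root
      equal to \<kappa> rather than its absolute value.\<close>
    then show ?thesis
      using frenet that by simp
  qed
  then show "\<forall>\<sigma>\<in>I. \<kappa> \<sigma> = sqrt ((k\<^sub>n \<sigma>)\<^sup>2 - (k\<^sub>g \<sigma>)\<^sup>2) \<and> \<tau> \<sigma> = \<tau>\<^sub>g \<sigma> + deriv \<phi> \<sigma>"
    by (simp add: assms(9) geodesic_torsion_def)
  have position: "\<gamma> \<sigma> - origin = \<omega>\<^sub>1 \<sigma> *\<^sub>R T \<sigma> + \<omega>\<^sub>2 \<sigma> *\<^sub>R N \<sigma> + \<omega>\<^sub>3 \<sigma> *\<^sub>R B \<sigma>" if "\<sigma> \<in> I" for \<sigma>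
    using assms(17) that V1 V2 by simp
  \<comment> \<open>The minus sign in the second equation comes from \<langle>N, N\<rangle> =
    -1.\<close>
  have \<omega>1: "lorentz_inner (\<gamma> \<sigma> - origin) (T \<sigma>) = \<omega>\<^sub>1 \<sigma>"
    and \<omega>2: "lorentz_inner (\<gamma> \<sigma> - origin) (N \<sigma>) = - \<omega>\<^sub>2 \<sigma>" if "\<sigma> \<in> I" for \<sigma>
    using frenet that
    by (simp_all add: position lorentz.add_left lorentz.scaleR_left
        lorentz_inner_commute[of "N \<sigma>" "T \<sigma>"] lorentz_inner_commute[of "B \<sigma>"])
  have \<omega>1': "(\<omega>\<^sub>1 has_real_derivative 1 - \<omega>\<^sub>2 \<sigma> * \<kappa> \<sigma>) (at \<sigma>)" if "\<sigma> \<in> I" for \<sigma>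
  proof -
    have "(\<gamma> has_vector_derivative T \<sigma>) (at \<sigma>)"
      using \<gamma>_diff[OF that] by (simp add: assms(3) unit_tangent_def vector_derivative_works[symmetric])
    then have "((\<lambda>x. \<gamma> x - origin) has_vector_derivative T \<sigma>) (at \<sigma>)"
      by (auto intro!: derivative_eq_intros)
    moreover have "(T has_vector_derivative \<kappa> \<sigma> *\<^sub>R N \<sigma>) (at \<sigma>)"
      using frenet that by simp
    ultimately have "((\<lambda>x. lorentz_inner (\<gamma> x - origin) (T x)) has_vector_derivative
        lorentz_inner (\<gamma> \<sigma> - origin) (\<kappa> \<sigma> *\<^sub>R N \<sigma>) + lorentz_inner (T \<sigma>) (T \<sigma>)) (at \<sigma>)"
      by (rule lorentz.has_vector_derivative)
    then have "((\<lambda>x. lorentz_inner (\<gamma> x - origin) (T x)) has_vector_derivative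
        1 - \<omega>\<^sub>2 \<sigma> * \<kappa> \<sigma>) (at \<sigma>)"
      using frenet that \<omega>2[OF that] by (simp add: lorentz.scaleR_right mult.commute)
    \<comment> \<open>Differentiability of \<open>\<omega>\<^sub>1\<close> is obtained here: it
      coincides with the differentiated pairing on the open set \<open>I\<close>.\<close>
    then have "(\<omega>\<^sub>1 has_vector_derivative 1 - \<omega>\<^sub>2 \<sigma> * \<kappa> \<sigma>) (at \<sigma>)"
      using \<gamma>_curve that \<omega>1 has_vector_derivative_transform_within_open by blast
    then show ?thesis
      by (simp add: has_real_derivative_iff_has_vector_derivative)
  qed
  have \<omega>2_nonzero: "\<omega>\<^sub>2 (s t) \<noteq> 0" if "t \<in> J" for t
  proof
    have st: "s t \<in> I"
      using assms(16) that by blast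
    \<comment> \<open>Without its N-part the position lies in the span of T and B, while the
      velocity is parallel to T. The angular momentum is then a multiple of B \<times> T, hence
      orthogonal to B.\<close>
    assume "\<omega>\<^sub>2 (s t) = 0"
    then have "angular_momentum m origin \<gamma> s t
        = (\<omega>\<^sub>3 (s t) * (m * deriv s t)) *\<^sub>R lorentz_cross (B (s t)) (T (s t))"
      using smooth_on_differentiable_at[OF assms(15) that]
      by (simp add: angular_momentum_def position[OF st] velocity_eq[of \<gamma> s t, OF \<gamma>_diff[OF st]] assms(3)
          lorentz_cross_add_left lorentz_cross_scaleR_left lorentz_cross_scaleR_right)
    then have "lorentz_inner (angular_momentum m origin \<gamma> s t) (B (s t)) = 0"
      by (simp add: lorentz.scaleR_left)
    \<comment> \<open>As T, N, B are mutually orthogonal and \<langle>B, B\<rangle> = 1, pairing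
      with B isolates \<open>h\<^sub>2\<close>, which was assumed nonzero.\<close>
    moreover have "lorentz_inner (angular_momentum m origin \<gamma> s t) (B (s t)) = h\<^sub>2 t"
      using assms(19) that frenet st
      by (simp add: V1[OF st] V2[OF st] lorentz.add_left lorentz.scaleR_left)
    ultimately show False
      using assms(20) that by simp
  qed
  have decomposition: "unique_decomposition (acceleration \<gamma> s t)
      (T (s t)) (oblique_axis T V\<^sub>1 \<omega>\<^sub>1 \<omega>\<^sub>2 (s t))
      (deriv (deriv s) t - (deriv s t)\<^sup>2 * \<kappa> (s t) * (1 / \<omega>\<^sub>2 (s t)) * \<omega>\<^sub>1 (s t))
      (\<kappa> (s t) * (deriv s t)\<^sup>2 * (1 / \<omega>\<^sub>2 (s t)) * sqrt \<bar>(\<omega>\<^sub>1 (s t))\<^sup>2 - (\<omega>\<^sub>2 (s t))\<^sup>2\<bar>)"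
    if "t \<in> J" for t
  proof -
    have st: "s t \<in> I"
      using assms(16) that by blast
    \<comment> \<open>Here \<open>K\<close> is \<kappa> N by the first Frenet equation, and N is
      \<open>V\<^sub>1\<close>.\<close>
    have "acceleration \<gamma> s t
        = deriv (deriv s) t *\<^sub>R T (s t) + ((deriv s t)\<^sup>2 * \<kappa> (s t)) *\<^sub>R V\<^sub>1 (s t)"
      using acceleration_eq[OF assms(13) that assms(15), of \<gamma> "\<kappa> (s t) *\<^sub>R N (s t)"]
        \<gamma>_diff assms(16) frenet st
      by (simp add: image_subset_iff assms(3) V1[OF st])
    then show ?thesis
      using unique_decomposition_oblique_axis[of T "s t" V\<^sub>1 \<omega>\<^sub>2 \<omega>\<^sub>1 "deriv (deriv s) t"
          "(deriv s t)\<^sup>2 * \<kappa> (s t)"] frenet st \<omega>2_nonzero[OF that] assms(21)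
      by (simp add: V1[OF st] mult.commute mult.left_commute)
  qed
  show "\<exists>F. (\<forall>\<sigma>\<in>I. (F has_real_derivative (1 - \<omega>\<^sub>2 \<sigma> * sqrt ((k\<^sub>n \<sigma>)\<^sup>2 - (k\<^sub>g \<sigma>)\<^sup>2))) (at \<sigma>)) \<and>
         (\<forall>\<sigma>\<in>I. F \<sigma> = \<omega>\<^sub>1 \<sigma>) \<and>
         (\<forall>t\<in>J. unique_decomposition (acceleration \<gamma> s t)
            (T (s t)) (oblique_axis T V\<^sub>1 \<omega>\<^sub>1 \<omega>\<^sub>2 (s t))
            (deriv (deriv s) t -
               (deriv s t)\<^sup>2 * sqrt ((k\<^sub>n (s t))\<^sup>2 - (k\<^sub>g (s t))\<^sup>2) * (1 / \<omega>\<^sub>2 (s t)) * F (s t))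
            (sqrt ((k\<^sub>n (s t))\<^sup>2 - (k\<^sub>g (s t))\<^sup>2) * (deriv s t)\<^sup>2 * (1 / \<omega>\<^sub>2 (s t)) *
               sqrt \<bar>(F (s t))\<^sup>2 - (\<omega>\<^sub>2 (s t))\<^sup>2\<bar>))"
  \<comment> \<open>The prescribed constant of integration forces the witness: the antiderivative
    has to be \<open>\<omega>\<^sub>1\<close> itself.\<close>
  proof (intro exI[of _ \<omega>\<^sub>1] conjI ballI)
    fix t assume t: "t \<in> J"
    then have "s t \<in> I"
      using assms(16) by blast
    from decomposition[OF t, folded \<kappa>[OF this]]
    show "unique_decomposition (acceleration \<gamma> s t)
            (T (s t)) (oblique_axis T V\<^sub>1 \<omega>\<^sub>1 \<omega>\<^sub>2 (s t))
            (deriv (deriv s) t -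
               (deriv s t)\<^sup>2 * sqrt ((k\<^sub>n (s t))\<^sup>2 - (k\<^sub>g (s t))\<^sup>2) * (1 / \<omega>\<^sub>2 (s t)) * \<omega>\<^sub>1 (s t))
            (sqrt ((k\<^sub>n (s t))\<^sup>2 - (k\<^sub>g (s t))\<^sup>2) * (deriv s t)\<^sup>2 * (1 / \<omega>\<^sub>2 (s t)) *
               sqrt \<bar>(\<omega>\<^sub>1 (s t))\<^sup>2 - (\<omega>\<^sub>2 (s t))\<^sup>2\<bar>)" .
  qed (simp_all add: \<omega>1' \<kappa>)
qed

end
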